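(* Let $\mathbb{F}$ be a field and let $A$ be an $n \times n$ matrix over $\mathbb{F}$ all of whose entries lie in $\{0,1,-1\}$. Then every principal submatrix of $A$ has even rank if and only if $A$ is skew-symmetric up to multiplication of rows/columns by $-1$, i.e., there exist diagonal matrices $D,E$ with diagonal entries in $\{1,-1\}$ such that $DAE$ is skew-symmetric.
   Context: An $n\times n$ matrix $M$ over a field is skew-symmetric if $M^T=-M$ and every diagonal entry of $M$ is zero. For $I \subseteq \{1,\ldots,n\}$, the principal submatrix of $A$ induced by $I$ is the matrix obtained from $A$ by deleting the rows and columns indexed by $\{1,\ldots,n\}\setminus I$; the principal submatrices are those induced by all subsets $I$. *)

theory Defs
  imports "Jordan_Normal_Form.DL_Rank" "Jordan_Normal_Form.DL_Submatrix"
begin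

definition skew_symmetric :: "'a::field mat \<Rightarrow> bool" where
  "skew_symmetric M \<longleftrightarrow> dim_row M = dim_col M \<and>
     transpose_mat M = - M \<and> (\<forall>i < dim_row M. M $$ (i, i) = 0)"

definition mat_rank :: "'a::field mat \<Rightarrow> nat" where
  "mat_rank M = vec_space.rank (dim_row M) M"

definition principal_submatrix :: "'a mat \<Rightarrow> nat set \<Rightarrow> 'a mat" where
  "principal_submatrix A I = submatrix A I I"

definition sign_diag :: "nat \<Rightarrow> 'a::field mat \<Rightarrow> bool" where
  "sign_diag n D \<longleftrightarrow> D \<in> carrier_mat n n \<and> diagonal_mat D \<and>
     (\<forall>i < n. D $$ (i, i) = 1 \<or> D $$ (i, i) = -1)"

end

theory Submission
  imports Defs
begin

text \<open>
  A pivot step lowers the rank by one, and two pivots at the positions (p, q) and (q, p) of an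
  alternating matrix leave an alternating matrix; hence alternating matrices have even rank, and
  so do all their principal submatrices, also after a rescaling of rows and columns.

  Conversely, even rank of the 1x1 and 2x2 principal submatrices gives a zero diagonal and a
  symmetric support, that is, a graph on the indices. It suffices to find signs f with
  f i * A i j = - f j * A j i, and these are built one vertex v at a time. Signs that work without
  v may be flipped on connected components, so they extend to v unless two neighbours of v in the
  same component demand opposite signs for v. A shortest path between two such neighbours
  together with v is a chordless cycle. Pivoting away two neighbouring vertices of the path at a
  time shortens this cycle by two, down to a 3-cycle or a 4-cycle, and shows that its principal
  submatrix has odd rank.
\<close>

subsection \<open>Rank of matrices indexed by arbitrary sets\<close>

text \<open>This encodes rank at most \<open>r\<close> as a product of an \<open>I\<close> by
  \<open>r\<close> and an \<open>r\<close> by \<open>J\<close> matrix. Arbitrary index sets allow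
  rows and columns to be deleted without renumbering the rest.\<close>

definition factors_through :: "'b set \<Rightarrow> 'c set \<Rightarrow> ('b \<Rightarrow> 'c \<Rightarrow> 'a::field) \<Rightarrow> nat \<Rightarrow> bool" where
  "factors_through I J M r \<longleftrightarrow>
     (\<exists>U V. \<forall>i\<in>I. \<forall>j\<in>J. M i j = (\<Sum>k<r. U i k * V k j))"

definition rank_on :: "'b set \<Rightarrow> 'c set \<Rightarrow> ('b \<Rightarrow> 'c \<Rightarrow> 'a::field) \<Rightarrow> nat" where
  "rank_on I J M = (LEAST r. factors_through I J M r)"

lemma factors_throughI:
  assumes "finite K" "card K = r"
    and "\<And>i j. i \<in> I \<Longrightarrow> j \<in> J \<Longrightarrow> M i j = (\<Sum>k\<in>K. U i k * V k j)"
  shows "factors_through I J M r"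
proof -
  obtain h where h: "bij_betw h {..<r} K"
    using ex_bij_betw_nat_finite[OF assms(1)] assms(2) by (auto simp: atLeast0LessThan)
  have "M i j = (\<Sum>k<r. U i (h k) * V (h k) j)" if "i \<in> I" "j \<in> J" for i j
    unfolding assms(3)[OF that] by (rule sum.reindex_bij_betw[OF h, symmetric])
  thus ?thesis
    unfolding factors_through_def by (intro exI[of _ "\<lambda>i k. U i (h k)"] exI[of _ "\<lambda>k j. V (h k) j"]) auto
qed

lemma factors_through_card:
  assumes "finite J"
  shows "factors_through I J M (card J)"
  by (rule factors_throughI[of J _ _ _ _ M "\<lambda>k j. if k = j then 1 else 0"])
    (use assms in \<open>auto simp: if_distrib cong: if_cong\<close>)

lemma factors_through_rank_on: "finite J \<Longrightarrow> factors_through I J M (rank_on I J M)"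
  unfolding rank_on_def by (rule LeastI, rule factors_through_card)

lemma rank_on_le: "factors_through I J M r \<Longrightarrow> rank_on I J M \<le> r"
  unfolding rank_on_def by (rule Least_le)

text \<open>Rows of \<open>U\<close> are pulled back along \<open>g\<close> and columns of
  \<open>V\<close> along \<open>h\<close>, and the factors \<open>a\<close> and \<open>b\<close> are
  absorbed into them. Invariance under rescaling and under reindexing both follow.\<close>

lemma factors_through_transfer:
  assumes "factors_through I J M r"
    and "\<And>i. i \<in> I' \<Longrightarrow> g i \<in> I" "\<And>j. j \<in> J' \<Longrightarrow> h j \<in> J"
    and "\<And>i j. i \<in> I' \<Longrightarrow> j \<in> J' \<Longrightarrow> M' i j = a i * M (g i) (h j) * b j"
  shows "factors_through I' J' M' r"
proof -
  obtain U V where "\<And>i j. i \<in> I \<Longrightarrow> j \<in> J \<Longrightarrow> M i j = (\<Sum>k<r. U i k * V k j)"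
    using assms(1) unfolding factors_through_def by blast
  with assms(2-) show ?thesis
    by (intro factors_throughI[of "{..<r}" _ _ _ _ "\<lambda>i k. a i * U (g i) k" "\<lambda>k j. V k (h j) * b j"])
      (auto simp: sum_distrib_left sum_distrib_right mult.assoc)
qed

lemma rank_on_cong:
  assumes "\<And>i j. i \<in> I \<Longrightarrow> j \<in> J \<Longrightarrow> M i j = N i j"
  shows "rank_on I J M = rank_on I J N"
  unfolding rank_on_def factors_through_def using assms by simp

lemma rank_on_scale:
  assumes "\<And>i. i \<in> I \<Longrightarrow> a i \<noteq> 0" "\<And>j. j \<in> J \<Longrightarrow> b j \<noteq> 0"
  shows "rank_on I J (\<lambda>i j. a i * M i j * b j) = rank_on I J M"
proof -
  have "factors_through I J (\<lambda>i j. a i * M i j * b j) r = factors_through I J M r" for r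
  proof
    assume "factors_through I J (\<lambda>i j. a i * M i j * b j) r"
    thus "factors_through I J M r"
      by (rule factors_through_transfer[where g = id and h = id
            and a = "\<lambda>i. inverse (a i)" and b = "\<lambda>j. inverse (b j)"]) (use assms in auto)
  next
    assume "factors_through I J M r"
    thus "factors_through I J (\<lambda>i j. a i * M i j * b j) r"
      by (rule factors_through_transfer[where g = id and h = id]) auto
  qed
  thus ?thesis unfolding rank_on_def by (intro arg_cong[where f = Least] ext)
qed

lemma rank_on_reindex:
  assumes "inj_on g I" "inj_on h J"
  shows "rank_on (g ` I) (h ` J) M = rank_on I J (\<lambda>i j. M (g i) (h j))"
proof -
  have "factors_through (g ` I) (h ` J) M r = factors_through I J (\<lambda>i j. M (g i) (h j)) r" for r
  proof
    assume "factors_through (g ` I) (h ` J) M r"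
    thus "factors_through I J (\<lambda>i j. M (g i) (h j)) r"
      by (rule factors_through_transfer[where g = g and h = h and a = "\<lambda>_. 1" and b = "\<lambda>_. 1"]) auto
  next
    assume "factors_through I J (\<lambda>i j. M (g i) (h j)) r"
    thus "factors_through (g ` I) (h ` J) M r"
      by (rule factors_through_transfer[where g = "the_inv_into I g" and h = "the_inv_into J h"
            and a = "\<lambda>_. 1" and b = "\<lambda>_. 1"]) (use assms in \<open>auto simp: the_inv_into_f_f\<close>)
  qed
  thus ?thesis unfolding rank_on_def by (intro arg_cong[where f = Least] ext)
qed

lemma rank_on_eq_0:
  assumes "\<And>i j. i \<in> I \<Longrightarrow> j \<in> J \<Longrightarrow> M i j = 0"
  shows "rank_on I J M = 0"
  using rank_on_le[of I J M 0] assms by (auto simp: factors_through_def)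

section \<open>Schur complements and the parity of alternating ranks\<close>

definition pivot :: "'b \<Rightarrow> 'c \<Rightarrow> ('b \<Rightarrow> 'c \<Rightarrow> 'a::field) \<Rightarrow> 'b \<Rightarrow> 'c \<Rightarrow> 'a" where
  "pivot p q M i j = M i j - M i q * M p j / M p q"

text \<open>\<open>M\<close> is the pivoted matrix plus one matrix of rank one, which costs one
  extra summand.\<close>

lemma factors_through_of_pivot:
  assumes "factors_through (I - {p}) (J - {q}) (pivot p q M) r" "M p q \<noteq> 0"
  shows "factors_through I J M (Suc r)"
proof -
  obtain U V where UV: "\<And>i j. i \<in> I - {p} \<Longrightarrow> j \<in> J - {q} \<Longrightarrow>
      pivot p q M i j = (\<Sum>k<r. U i k * V k j)"
    using assms(1) unfolding factors_through_def by blast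
  \<comment> \<open>Index \<open>r\<close> carries the rank-one term. The given factors say nothing
    about row \<open>p\<close> and column \<open>q\<close>; the pivoted matrix vanishes there, so
    the other summands are set to zero.\<close>
  define U' where "U' = (\<lambda>i k. if k = r then M i q / M p q else if i = p then 0 else U i k)"
  define V' where "V' = (\<lambda>k j. if k = r then M p j else if j = q then 0 else V k j)"
  have "M i j = (\<Sum>k<Suc r. U' i k * V' k j)" if "i \<in> I" "j \<in> J" for i j
  proof (cases "i = p \<or> j = q")
    case True
    hence "(\<Sum>k<r. U' i k * V' k j) = 0" by (intro sum.neutral) (auto simp: U'_def V'_def)
    with True assms(2) show ?thesis by (auto simp: U'_def V'_def)
  next
    case False
    hence "(\<Sum>k<r. U' i k * V' k j) = (\<Sum>k<r. U i k * V k j)"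
      by (intro sum.cong) (auto simp: U'_def V'_def)
    also have "\<dots> = pivot p q M i j" using False that UV by simp
    finally show ?thesis by (simp add: U'_def V'_def pivot_def)
  qed
  thus ?thesis unfolding factors_through_def by blast
qed

text \<open>Pivoting changes only the right factor, from \<open>V\<close> to \<open>W\<close>. The
  pivoted row \<open>p\<close> is zero, which is a linear relation between the rows of
  \<open>W\<close>; it eliminates one row \<open>l\<close> with \<open>U p l\<close>
  nonzero.\<close>

lemma factors_through_pivot:
  fixes M :: "'b \<Rightarrow> 'c \<Rightarrow> 'a::field"
  assumes "factors_through I J M r" "p \<in> I" "q \<in> J" "M p q \<noteq> 0"
  shows "r > 0 \<and> factors_through (I - {p}) (J - {q}) (pivot p q M) (r - 1)"
proof -
  obtain U V where UV: "\<And>i j. i \<in> I \<Longrightarrow> j \<in> J \<Longrightarrow> M i j = (\<Sum>k<r. U i k * V k j)"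
    using assms(1) unfolding factors_through_def by blast
  obtain l where l: "l < r" "U p l \<noteq> 0"
    using assms(4) unfolding UV[OF assms(2,3)]
    by (metis (no_types, lifting) lessThan_iff mult_zero_left sum.neutral)
  define W where "W = (\<lambda>k j. V k j - V k q * M p j / M p q)"
  have W: "pivot p q M i j = (\<Sum>k<r. U i k * W k j)" if "i \<in> I" "j \<in> J" for i j
    using that assms(3) unfolding pivot_def W_def
    by (simp add: UV right_diff_distrib sum_subtractf sum_distrib_right sum_divide_distrib mult.assoc)
  have split: "(\<Sum>k<r. f k) = f l + (\<Sum>k\<in>{..<r} - {l}. f k)" for f :: "nat \<Rightarrow> 'a"
    using l(1) by (simp add: sum.remove)
  have eq: "pivot p q M i j = (\<Sum>k\<in>{..<r} - {l}. (U i k - U i l * U p k / U p l) * W k j)"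
    if ij: "i \<in> I" "j \<in> J" for i j
  proof -
    have "pivot p q M p j = 0" using assms(4) by (simp add: pivot_def)
    hence "U p l * W l j = - (\<Sum>k\<in>{..<r} - {l}. U p k * W k j)"
      using W[OF assms(2) ij(2)] unfolding split by (simp add: add_eq_0_iff2)
    hence "U i l / U p l * (U p l * W l j) = - (\<Sum>k\<in>{..<r} - {l}. U i l * U p k / U p l * W k j)"
      by (simp add: sum_distrib_left mult.assoc)
    hence "U i l * W l j = - (\<Sum>k\<in>{..<r} - {l}. U i l * U p k / U p l * W k j)"
      using l(2) by simp
    thus ?thesis
      unfolding W[OF ij] split by (simp add: left_diff_distrib sum_subtractf)
  qed
  have "factors_through (I - {p}) (J - {q}) (pivot p q M) (r - 1)"
    by (rule factors_throughI[of "{..<r} - {l}" _ _ _ _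
          "\<lambda>i k. U i k - U i l * U p k / U p l" W]) (use l eq in auto)
  with l show ?thesis by auto
qed

lemma rank_on_pivot:
  assumes "finite J" "p \<in> I" "q \<in> J" "M p q \<noteq> 0"
  shows "rank_on I J M = Suc (rank_on (I - {p}) (J - {q}) (pivot p q M))"
proof (rule antisym)
  show "rank_on I J M \<le> Suc (rank_on (I - {p}) (J - {q}) (pivot p q M))"
    using assms by (intro rank_on_le factors_through_of_pivot[of I p J q] factors_through_rank_on) auto
  have "rank_on I J M > 0 \<and>
      factors_through (I - {p}) (J - {q}) (pivot p q M) (rank_on I J M - 1)"
    by (intro factors_through_pivot factors_through_rank_on) (use assms in auto)
  thus "Suc (rank_on (I - {p}) (J - {q}) (pivot p q M)) \<le> rank_on I J M"
    using rank_on_le by fastforce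
qed

text \<open>When both diagonal entries vanish, this is the Schur complement of the 2x2 block on
  \<open>p\<close> and \<open>q\<close>.\<close>

definition pivot2 :: "'b \<Rightarrow> 'b \<Rightarrow> ('b \<Rightarrow> 'b \<Rightarrow> 'a::field) \<Rightarrow> 'b \<Rightarrow> 'b \<Rightarrow> 'a" where
  "pivot2 p q M i j = M i j - M i q * M p j / M p q - M i p * M q j / M q p"

text \<open>The zero diagonal entries make the two pivots independent: the first leaves row
  \<open>q\<close> and column \<open>p\<close> unchanged, so \<open>M q p\<close> is still available
  for the second.\<close>

lemma rank_on_pivot2:
  assumes "finite I" "p \<in> I" "q \<in> I" "M p p = 0" "M q q = 0" "M p q \<noteq> 0" "M q p \<noteq> 0"
  shows "rank_on I I M = Suc (Suc (rank_on (I - {p, q}) (I - {p, q}) (pivot2 p q M)))"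
proof -
  have ne: "p \<noteq> q" using assms by auto
  have sets: "I - {p} - {q} = I - {p, q}" "I - {q} - {p} = I - {p, q}" by auto
  have "rank_on I I M = Suc (rank_on (I - {p}) (I - {q}) (pivot p q M))"
    by (rule rank_on_pivot) (use assms in auto)
  also have "rank_on (I - {p}) (I - {q}) (pivot p q M)
      = Suc (rank_on (I - {p} - {q}) (I - {q} - {p}) (pivot q p (pivot p q M)))"
    by (rule rank_on_pivot) (use assms ne in \<open>auto simp: pivot_def\<close>)
  also have "pivot q p (pivot p q M) = pivot2 p q M"
    using assms by (auto simp: pivot_def pivot2_def fun_eq_iff)
  finally show ?thesis unfolding sets .
qed

lemma even_rank_on_alternating:
  assumes "finite I"
    and "\<And>i. i \<in> I \<Longrightarrow> M i i = 0" "\<And>i j. i \<in> I \<Longrightarrow> j \<in> I \<Longrightarrow> M i j = - M j i"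
  shows "even (rank_on I I M)"
  using assms
proof (induction I arbitrary: M rule: finite_psubset_induct)
  case (psubset I)
  show ?case
  proof (cases "\<exists>p\<in>I. \<exists>q\<in>I. M p q \<noteq> 0")
    case False
    thus ?thesis by (subst rank_on_eq_0) auto
  next
    case True
    then obtain p q where pq: "p \<in> I" "q \<in> I" "M p q \<noteq> 0" by blast
    have qp: "M q p = - M p q" using psubset.prems pq by blast
    \<comment> \<open>Since \<open>M q p = - M p q\<close>, the first correction term at
      \<open>(i, j)\<close> is the negative of the second at \<open>(j, i)\<close>. On the diagonal
      the two cancel; this is checked separately because skewness alone does not give it in
      characteristic 2.\<close>
    have "even (rank_on (I - {p, q}) (I - {p, q}) (pivot2 p q M))"
    proof (rule psubset.IH)
      fix i assume i: "i \<in> I - {p, q}"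
      have "M i q = - M q i" "M i p = - M p i" using psubset.prems(2) i pq by blast+
      thus "pivot2 p q M i i = 0"
        using psubset.prems(1)[of i] i qp pq by (simp add: pivot2_def)
      fix j assume j: "j \<in> I - {p, q}"
      have "M i q = - M q i" "M i p = - M p i" "M j q = - M q j" "M j p = - M p j" "M i j = - M j i"
        using psubset.prems(2) i j pq by blast+
      thus "pivot2 p q M i j = - pivot2 p q M j i"
        using qp by (simp add: pivot2_def mult.commute)
    qed (use pq in auto)
    moreover have "M p p = 0" "M q q = 0" using psubset.prems(1) pq by auto
    ultimately show ?thesis
      using rank_on_pivot2[of I p q M] pq qp psubset.hyps by simp
  qed
qed

subsection \<open>Agreement with the column rank\<close>

text \<open>A maximal independent set \<open>S\<close> of columns is the left factor of a
  factorization of size \<open>card S\<close>. Conversely, a factorization of size \<open>r\<close>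
  puts \<open>S\<close> into the span of \<open>r\<close> vectors, and Steinitz exchange gives
  \<open>card S \<le> r\<close>.\<close>

lemma mat_rank_eq_rank_on:
  fixes B :: "'a::field mat"
  shows "mat_rank B = rank_on {..<dim_row B} {..<dim_col B} (\<lambda>i j. B $$ (i, j))"
proof -
  define n where "n = dim_row B"
  interpret vec_space "TYPE('a)" n .
  have B: "B \<in> carrier_mat n (dim_col B)" by (auto simp: n_def)
  have colsB: "set (cols B) \<subseteq> carrier_vec n" using cols_dim B by blast
  obtain S where S: "maximal S (\<lambda>T. T \<subseteq> set (cols B) \<and> lin_indpt T)"
    using maximal_exists[of "(\<lambda>T. T \<subseteq> set (cols B) \<and> lin_indpt T)" "card (set (cols B))" "{}"]
    by (meson List.finite_set card_mono empty_iff empty_subsetI finite_lin_indpt2 rev_finite_subset)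
  have SB: "S \<subseteq> set (cols B)" and Sli: "lin_indpt S" using S by (auto simp: maximal_def)
  have Sc: "S \<subseteq> carrier_vec n" using SB colsB by blast
  have Sfin: "finite S" using SB finite_subset by blast
  have rank: "mat_rank B = card S"
    unfolding mat_rank_def n_def[symmetric] by (rule rank_card_indpt[OF B S])
  have col_span: "col B j \<in> span S" if j: "j < dim_col B" for j
  proof (rule ccontr)
    assume ns: "col B j \<notin> span S"
    have cB: "col B j \<in> set (cols B)" using j by (simp add: cols_def)
    hence cc: "col B j \<in> carrier_vec n" using colsB by blast
    have nS: "col B j \<notin> S" using ns Sc span_mem by auto
    have "lin_indpt (insert (col B j) S)"
      using lin_dep_iff_in_span[of S "col B j"] Sc Sli cc nS ns by simp
    with SB cB S nS show False unfolding maximal_def by blast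
  qed
  have "\<exists>a. col B j = lincomb a S" if "j < dim_col B" for j
    using finite_span[of S] Sfin Sc col_span[OF that] by auto
  then obtain a where a: "\<And>j. j < dim_col B \<Longrightarrow> col B j = lincomb (a j) S" by metis
  have "factors_through {..<n} {..<dim_col B} (\<lambda>i j. B $$ (i, j)) (card S)"
  proof (rule factors_throughI[OF Sfin refl])
    fix i j assume "i \<in> {..<n}" "j \<in> {..<dim_col B}"
    hence ij: "i < n" "j < dim_col B" by auto
    have "B $$ (i, j) = col B j $ i" using ij by (simp add: n_def)
    also have "\<dots> = (\<Sum>x\<in>S. x $ i * a j x)"
      unfolding a[OF ij(2)] lincomb_index[OF ij(1) Sc] by (simp add: mult.commute)
    finally show "B $$ (i, j) = (\<Sum>x\<in>S. x $ i * a j x)" .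
  qed
  hence le: "rank_on {..<n} {..<dim_col B} (\<lambda>i j. B $$ (i, j)) \<le> card S" by (rule rank_on_le)
  define r where "r = rank_on {..<n} {..<dim_col B} (\<lambda>i j. B $$ (i, j))"
  have "factors_through {..<n} {..<dim_col B} (\<lambda>i j. B $$ (i, j)) r"
    unfolding r_def by (rule factors_through_rank_on) simp
  then obtain U V where UV: "\<And>i j. i < n \<Longrightarrow> j < dim_col B \<Longrightarrow>
      B $$ (i, j) = (\<Sum>k<r. U i k * V k j)"
    unfolding factors_through_def by blast
  define P where "P = mat n r (\<lambda>(i, k). U i k)"
  have P: "P \<in> carrier_mat n r" by (simp add: P_def)
  have "x \<in> span (set (cols P))" if x: "x \<in> S" for x
  proof -
    obtain j where j: "j < dim_col B" "x = col B j"
      using x SB by (auto simp: cols_def)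
    have "x = P *\<^sub>v vec r (\<lambda>k. V k j)"
      by (rule eq_vecI) (use j UV in \<open>auto simp: P_def n_def scalar_prod_def atLeast0LessThan\<close>)
    moreover have "x \<in> carrier_vec n" using x Sc by blast
    ultimately have "x \<in> col_space P"
      using P by (subst col_space_eq) auto
    thus ?thesis by (simp add: col_space_def)
  qed
  hence "S \<subseteq> span (set (cols P))" by blast
  moreover have "set (cols P) \<subseteq> carrier_vec n" using cols_dim[of P] P by auto
  \<comment> \<open>Only the cardinality bound of the exchange lemma matters: the left side is
    nonnegative, hence so is the right.\<close>
  ultimately obtain C :: "'a vec set" where "int (card C) \<le> int (card (set (cols P))) - int (card S)"
    using replacement[of S "set (cols P)"] Sfin Sli by auto
  hence "card S \<le> card (set (cols P))" by linarith
  also have "\<dots> \<le> r" using card_length[of "cols P"] P by simp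
  finally show ?thesis using le rank by (simp add: r_def n_def)
qed

lemma bij_betw_pick:
  assumes "finite I"
  shows "bij_betw (pick I) {..<card I} I"
proof -
  have "inj_on (pick I) {..<card I}"
    by (rule strict_mono_on_imp_inj_on) (auto simp: monotone_on_def pick_mono_le)
  moreover have "pick I ` {..<card I} \<subseteq> I" by (auto simp: pick_in_set_le)
  ultimately show ?thesis
    using assms by (simp add: bij_betw_def card_image card_subset_eq)
qed

text \<open>\<open>submatrix\<close> renumbers \<open>I\<close> through \<open>pick\<close>, and
  \<open>rank_on\<close> does not see a renumbering. From here on, principal submatrices are
  restrictions to index sets.\<close>

lemma mat_rank_principal_submatrix:
  assumes "A \<in> carrier_mat n n" "I \<subseteq> {0..<n}"
  shows "mat_rank (principal_submatrix A I) = rank_on I I (\<lambda>i j. A $$ (i, j))"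
proof -
  let ?B = "principal_submatrix A I"
  have fin: "finite I" using assms(2) finite_subset by blast
  have I: "{i. i < n \<and> i \<in> I} = I" using assms(2) by auto
  have dim: "dim_row ?B = card I" "dim_col ?B = card I"
    using assms(1) by (auto simp: principal_submatrix_def dim_submatrix I)
  have "mat_rank ?B = rank_on {..<card I} {..<card I} (\<lambda>i j. A $$ (pick I i, pick I j))"
    unfolding mat_rank_eq_rank_on dim
    by (rule rank_on_cong) (use assms(1) in \<open>auto simp: principal_submatrix_def submatrix_index I\<close>)
  also have "\<dots> = rank_on (pick I ` {..<card I}) (pick I ` {..<card I}) (\<lambda>i j. A $$ (i, j))"
    using bij_betw_pick[OF fin] by (subst rank_on_reindex) (auto simp: bij_betw_def)
  finally show ?thesis using bij_betw_pick[OF fin] by (simp add: bij_betw_def)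
qed

subsection \<open>Chordless cycles with inconsistent signs\<close>

lemma rank_on_single_entry:
  assumes "finite J" "p \<in> I" "q \<in> J" "M p q \<noteq> 0"
    and "\<And>i j. i \<in> I \<Longrightarrow> j \<in> J \<Longrightarrow> (i, j) \<noteq> (p, q) \<Longrightarrow> M i j = 0"
  shows "rank_on I J M = 1"
proof -
  have "rank_on (I - {p}) (J - {q}) (pivot p q M) = 0"
    by (rule rank_on_eq_0) (use assms(2,3,5) in \<open>auto simp: pivot_def\<close>)
  thus ?thesis using rank_on_pivot[of J p I q M] assms(1-4) by simp
qed

text \<open>
  The cycle is 0, 1, ..., m. It is skew except for the pair (0, 1), where it is symmetric.
\<close>
lemma odd_rank_on_twisted_cycle:
  fixes C :: "nat \<Rightarrow> nat \<Rightarrow> 'a::field"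
  assumes "m \<ge> 2" "(1::'a) \<noteq> -1"
    and "\<And>i. i \<le> m \<Longrightarrow> C i i = 0"
    and "\<And>i. 1 \<le> i \<Longrightarrow> i < m \<Longrightarrow> C i (Suc i) \<in> {1, -1}"
    and "\<And>i j. 1 \<le> i \<Longrightarrow> Suc i < j \<Longrightarrow> j \<le> m \<Longrightarrow> C i j = 0"
    and "\<And>i j. 1 \<le> i \<Longrightarrow> i \<le> m \<Longrightarrow> 1 \<le> j \<Longrightarrow> j \<le> m \<Longrightarrow> C i j = - C j i"
    and "C 0 1 \<in> {1, -1}" "C 1 0 = C 0 1"
    and "C 0 m \<in> {1, -1}" "C m 0 = - C 0 m"
    and "\<And>k. 1 < k \<Longrightarrow> k < m \<Longrightarrow> C 0 k = 0" "\<And>k. 1 < k \<Longrightarrow> k < m \<Longrightarrow> C k 0 = 0"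
  shows "odd (rank_on {..m} {..m} C)"
  using assms
proof (induction m arbitrary: C rule: less_induct)
  case (less m)
  note two = less.prems(1) and ne = less.prems(2) and diag = less.prems(3) and path = less.prems(4)
    and far = less.prems(5) and skew = less.prems(6) and first = less.prems(7,8)
    and last = less.prems(9,10) and mid = less.prems(11,12)
  have ne': "(-1::'a) \<noteq> 1" using ne by metis
  have ne2: "(2::'a) \<noteq> 0"
    using ne by (metis one_add_one add_eq_0_iff)
  obtain n where m: "m = Suc (Suc n)" using two by (metis add_2_eq_Suc le_Suc_ex)
  have e: "C (Suc n) m \<in> {1, -1}" using path[of "Suc n"] by (simp add: m)
  have e': "C m (Suc n) = - C (Suc n) m" by (rule skew) (auto simp: m)
  have e0: "C (Suc n) m \<noteq> 0" using e by auto
  \<comment> \<open>The last two vertices \<open>m\<close> and \<open>Suc n\<close> of the cycle are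
    pivoted away.\<close>
  define D where "D = pivot2 m (Suc n) C"
  have D: "D i j = C i j + (C i (Suc n) * C m j - C i m * C (Suc n) j) / C (Suc n) m" for i j
    unfolding D_def pivot2_def e' by (simp add: diff_divide_distrib)
  have "{..m} - {m, Suc n} = {..n}" by (auto simp: m)
  hence rank: "rank_on {..m} {..m} C = Suc (Suc (rank_on {..n} {..n} D))"
    unfolding D_def using rank_on_pivot2[of "{..m}" m "Suc n" C] diag e0 e' by (simp add: m)
  have farm: "C i m = 0" "C m i = 0" if "1 \<le> i" "i \<le> n" for i
  proof -
    show "C i m = 0" by (rule far) (use that in \<open>auto simp: m\<close>)
    thus "C m i = 0" using skew[of m i] that by (simp add: m)
  qed
  have farn: "C i (Suc n) = 0" "C (Suc n) i = 0" if "1 \<le> i" "i < n" for i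
  proof -
    show "C i (Suc n) = 0" by (rule far) (use that in \<open>auto simp: m\<close>)
    thus "C (Suc n) i = 0" using skew[of "Suc n" i] that by (simp add: m)
  qed
  have "odd (rank_on {..n} {..n} D)"
  proof (cases "n = 0")
    case True
    \<comment> \<open>Triangle: the symmetric pair \<open>(0, 1)\<close> makes the two corrections
      add up instead of cancelling, and 2 is nonzero.\<close>
    have "D 0 0 = - 2 * C 0 1 * C 0 m / C (Suc n) m"
      unfolding D using diag[of 0] first last e0 by (simp add: True field_simps)
    hence "D 0 0 \<noteq> 0" using ne2 first last e0 by auto
    hence "rank_on {..n} {..n} D = 1" by (intro rank_on_single_entry[of _ 0 _ 0]) (auto simp: True)
    thus ?thesis by simp
  next
    case False
    have mid0: "C 0 (Suc n) = 0" "C (Suc n) 0 = 0" using mid[of "Suc n"] False by (auto simp: m)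
    \<comment> \<open>Among the remaining vertices, only 0 is adjacent to \<open>m\<close> and only
      \<open>n\<close> to \<open>Suc n\<close>, so the correction is confined to the pair of 0 and
      \<open>n\<close>.\<close>
    have same: "D i j = C i j" if "i \<le> n" "j \<le> n" "(i, j) \<noteq> (0, n)" "(i, j) \<noteq> (n, 0)" for i j
    proof -
      have "C i (Suc n) * C m j = 0"
        using that farm(2)[of j] farn(1)[of i] mid0 by (cases "j = 0"; cases "i = 0") auto
      moreover have "C i m * C (Suc n) j = 0"
        using that farm(1)[of i] farn(2)[of j] mid0 by (cases "j = 0"; cases "i = 0") auto
      ultimately show ?thesis by (auto simp: D)
    qed
    \<comment> \<open>\<open>t\<close> is the skew contribution that closes the shortened cycle
      between 0 and \<open>n\<close>.\<close>
    define t where "t = C n (Suc n) * C 0 m / C (Suc n) m"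
    have en: "C n (Suc n) \<in> {1, -1}" using path[of n] False by (simp add: m)
    have t: "t \<in> {1, -1}" using en last e unfolding t_def by auto
    have D0n: "D 0 n = C 0 n + t"
      using mid0 skew[of "Suc n" n] False by (simp add: D t_def m)
    have Dn0: "D n 0 = C n 0 - t"
      using mid0 last by (simp add: D t_def)
    show ?thesis
    proof (cases "n = 1")
      case True
      \<comment> \<open>4-cycle: the skew \<open>t\<close> falls on the symmetric pair
        \<open>(0, 1)\<close>, so one of the two entries doubles and the other becomes zero.\<close>
      have z: "D 0 0 = 0" "D 1 1 = 0" using same[of 0 0] same[of 1 1] diag True by (auto simp: m)
      have "t = C 0 1 \<or> t = - C 0 1" using t first by auto
      thus ?thesis
      proof
        assume "t = C 0 1"
        hence "D 0 1 = 2 * C 0 1" "D 1 0 = 0" using D0n Dn0 first True by auto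
        hence "rank_on {..n} {..n} D = 1"
          using ne2 first z by (intro rank_on_single_entry[of _ 0 _ 1]) (auto simp: True le_Suc_eq)
        thus ?thesis by simp
      next
        assume "t = - C 0 1"
        hence "D 1 0 = 2 * C 0 1" "D 0 1 = 0" using D0n Dn0 first True by auto
        hence "rank_on {..n} {..n} D = 1"
          using ne2 first z by (intro rank_on_single_entry[of _ 1 _ 0]) (auto simp: True le_Suc_eq)
        thus ?thesis by simp
      qed
    next
      case n1: False
      have n: "2 \<le> n" using n1 False by simp
      have c0: "C 0 n = 0" "C n 0 = 0" using mid[of n] n by (auto simp: m)
      show ?thesis
      proof (rule less.IH)
        show "n < m" "2 \<le> n" "(1::'a) \<noteq> -1" using n ne by (auto simp: m)
        show "D i i = 0" if "i \<le> n" for i using same[of i i] diag[of i] that False by (cases "i = 0") (auto simp: m)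
        show "D i (Suc i) \<in> {1, -1}" if "1 \<le> i" "i < n" for i
          using same[of i "Suc i"] path[of i] that by (simp add: m)
        show "D i j = 0" if "1 \<le> i" "Suc i < j" "j \<le> n" for i j
          using same[of i j] far[of i j] that by (simp add: m)
        show "D i j = - D j i" if "1 \<le> i" "i \<le> n" "1 \<le> j" "j \<le> n" for i j
          using same[of i j] same[of j i] skew[of i j] that by (simp add: m)
        show "D 0 1 \<in> {1, -1}" "D 1 0 = D 0 1" using same[of 0 1] same[of 1 0] first n by auto
        show "D 0 n \<in> {1, -1}" "D n 0 = - D 0 n" using D0n Dn0 c0 t by auto
        show "D 0 k = 0" "D k 0 = 0" if "1 < k" "k < n" for k
          using same[of 0 k] same[of k 0] mid[of k] that by (auto simp: m)
      qed
    qed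
  qed
  thus ?case using rank by simp
qed

text \<open>By \<open>sign\<close>, the vertex \<open>x\<close> is joined to \<open>v\<close> by a
  nonzero symmetric pair and \<open>y\<close> by a nonzero skew one. A shortest connection between
  two such vertices closes up through \<open>v\<close> to an induced twisted cycle.\<close>

lemma no_sign_conflict_along_path:
  fixes N :: "'b \<Rightarrow> 'b \<Rightarrow> 'a::field"
  assumes v: "v \<notin> J"
    and entries: "\<And>i j. i \<in> insert v J \<Longrightarrow> j \<in> insert v J \<Longrightarrow> N i j \<in> {0, 1, -1}"
    and diag: "\<And>i. i \<in> insert v J \<Longrightarrow> N i i = 0"
    and skew: "\<And>i j. i \<in> J \<Longrightarrow> j \<in> J \<Longrightarrow> N i j = - N j i"
    and sign: "\<And>j. j \<in> J \<Longrightarrow> N j v = N v j \<or> N j v = - N v j"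
    and even: "\<And>K. K \<subseteq> insert v J \<Longrightarrow> finite K \<Longrightarrow> even (rank_on K K N)"
    and x: "x \<in> J" "N x v \<noteq> - N v x"
    and y: "N y v \<noteq> N v y"
    and reach: "(x, y) \<in> {(a, b). a \<in> J \<and> b \<in> J \<and> N a b \<noteq> 0}\<^sup>*"
  shows False
proof -
  \<comment> \<open>The endpoints are left free instead of being fixed to \<open>x\<close> and
    \<open>y\<close>, so that minimality of \<open>m\<close> also rules out interior vertices
    adjacent to \<open>v\<close>.\<close>
  define P where "P = (\<lambda>m p. p 0 \<in> J \<and> N (p 0) v \<noteq> - N v (p 0) \<and> N (p m) v \<noteq> N v (p m) \<and>
     (\<forall>k<m. p k \<in> J \<and> p (Suc k) \<in> J \<and> N (p k) (p (Suc k)) \<noteq> 0))"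
  have "\<exists>m p. P m p"
    using rtrancl_imp_relpow[OF reach] x y unfolding relpow_fun_conv P_def by auto
  define m where "m = (LEAST m. \<exists>p. P m p)"
  obtain p where p: "P m p"
    unfolding m_def using LeastI_ex[OF \<open>\<exists>m p. P m p\<close>] by blast
  have minimal: "m \<le> m'" if "P m' p'" for m' p'
    unfolding m_def by (rule Least_le) (use that in blast)
  have p0: "p 0 \<in> J" "N (p 0) v \<noteq> - N v (p 0)" and pm: "N (p m) v \<noteq> N v (p m)"
    and adj: "\<And>k. k < m \<Longrightarrow> N (p k) (p (Suc k)) \<noteq> 0"
    using p by (auto simp: P_def)
  have pJ: "p k \<in> J" if "k \<le> m" for k
    using p that by (cases k) (auto simp: P_def)
  have sym0: "N (p 0) v = N v (p 0)" using sign p0 by blast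
  have symm: "N (p m) v = - N v (p m)" using sign pJ[of m] pm by blast
  have m: "m > 0" using p0 pm sign by (cases "m = 0") auto
  have ne: "(1::'a) \<noteq> -1"
  proof
    assume "(1::'a) = -1"
    moreover have "N v (p 0) \<in> {0, 1, -1}" using entries p0 by simp
    ultimately show False using p0 sym0 by auto
  qed
  have interior: "N v (p k) = 0 \<and> N (p k) v = 0" if k: "0 < k" "k < m" for k
  proof -
    \<comment> \<open>Neither the path cut off at \<open>k\<close> nor the path started at
      \<open>k\<close> qualifies, so the pair is both symmetric and skew; as 1 differs from -1, it
      is zero.\<close>
    have "\<not> P k p" using minimal k by force
    hence 1: "N (p k) v = N v (p k)" using p k by (auto simp: P_def)
    have "\<not> P (m - k) (\<lambda>i. p (k + i))" using minimal[of "m - k"] k by force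
    hence 2: "N (p k) v = - N v (p k)"
      using p k pJ[of k] by (auto simp: P_def)
    have "N v (p k) \<in> {0, 1, -1}" using entries pJ k by simp
    thus ?thesis using 1 2 ne by auto
  qed
  have chordless: "N (p i) (p j) = 0" if ij: "Suc i < j" "j \<le> m" for i j
  proof (rule ccontr)
    assume nz: "N (p i) (p j) \<noteq> 0"
    \<comment> \<open>A chord gives the shortcut \<open>p'\<close>, which skips the \<open>d\<close>
      vertices strictly between positions \<open>i\<close> and \<open>j\<close>.\<close>
    define d where "d = j - Suc i"
    define p' where "p' = (\<lambda>k. if k \<le> i then p k else p (k + d))"
    have "p' k \<in> J \<and> p' (Suc k) \<in> J \<and> N (p' k) (p' (Suc k)) \<noteq> 0" if k: "k < m - d" for k
    proof -
      consider "k < i" | "k = i" | "k > i" by linarith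
      thus ?thesis
      proof cases
        case 1
        thus ?thesis using adj[of k] pJ ij by (simp add: p'_def)
      next
        case 2
        thus ?thesis using nz pJ ij by (simp add: p'_def d_def)
      next
        case 3
        thus ?thesis using adj[of "k + d"] pJ ij k by (simp add: p'_def)
      qed
    qed
    moreover have "p' 0 = p 0" "p' (m - d) = p m" using ij by (auto simp: p'_def d_def)
    ultimately have "P (m - d) p'" using p0 pm by (simp add: P_def)
    hence "m \<le> m - d" by (rule minimal)
    thus False using ij by (simp add: d_def)
  qed
  have distinct: "p i \<noteq> p j" if ij: "i < j" "j \<le> m" for i j
  proof
    \<comment> \<open>A repetition of the last vertex gives a shorter path; any other makes the edge
      leaving \<open>p j\<close> a chord from \<open>i\<close> to \<open>Suc j\<close>.\<close>
    assume eq: "p i = p j"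
    show False
    proof (cases "j = m")
      case True
      hence "P i p" using p eq ij by (auto simp: P_def)
      thus False using minimal ij by force
    next
      case False
      hence "j < m" using ij by simp
      thus False using adj[of j] chordless[of i "Suc j"] ij eq by simp
    qed
  qed
  \<comment> \<open>Position 0 is taken by \<open>v\<close> and the path moves up by one, so the
    symmetric pair sits at \<open>(0, 1)\<close> and the last position is
    \<open>Suc m\<close>.\<close>
  define q where "q = (\<lambda>k. case k of 0 \<Rightarrow> v | Suc k \<Rightarrow> p k)"
  have q: "q 0 = v" "\<And>k. q (Suc k) = p k" by (simp_all add: q_def)
  have q': "q k = p (k - 1)" if "1 \<le> k" for k using that by (cases k) (auto simp: q)
  have qI: "q k \<in> insert v J" if "k \<le> Suc m" for k
    using that pJ by (cases k) (auto simp: q)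
  have "q i \<noteq> q j" if "i < j" "j \<le> Suc m" for i j
    using that distinct[of "i - 1" "j - 1"] pJ[of "j - 1"] v by (cases i; cases j) (auto simp: q)
  hence inj: "inj_on q {..Suc m}" by (intro linorder_inj_onI) auto
  define C where "C = (\<lambda>i j. N (q i) (q j))"
  have unit: "N i j \<in> {1, -1}" if "i \<in> insert v J" "j \<in> insert v J" "N i j \<noteq> 0" for i j
    using entries that by blast
  have "odd (rank_on {..Suc m} {..Suc m} C)"
  proof (rule odd_rank_on_twisted_cycle)
    show "2 \<le> Suc m" "(1::'a) \<noteq> -1" using m ne by auto
    show "C i i = 0" if "i \<le> Suc m" for i using diag qI that by (simp add: C_def)
    show "C i (Suc i) \<in> {1, -1}" if "1 \<le> i" "i < Suc m" for i
      unfolding C_def using that adj[of "i - 1"] qI[of i] qI[of "Suc i"]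
      by (intro unit) (auto simp: q q')
    show "C i j = 0" if "1 \<le> i" "Suc i < j" "j \<le> Suc m" for i j
      using that chordless[of "i - 1" "j - 1"] by (simp add: C_def q')
    show "C i j = - C j i" if "1 \<le> i" "i \<le> Suc m" "1 \<le> j" "j \<le> Suc m" for i j
      unfolding C_def using that pJ by (intro skew) (auto simp: q')
    show "C 0 1 \<in> {1, -1}" unfolding C_def
      using p0 sym0 by (intro unit) (auto simp: q q')
    show "C 1 0 = C 0 1" using sym0 by (simp add: C_def q q')
    show "C 0 (Suc m) \<in> {1, -1}" unfolding C_def
      using pJ[of m] pm symm by (intro unit) (auto simp: q)
    show "C (Suc m) 0 = - C 0 (Suc m)" using symm by (simp add: C_def q)
    show "C 0 k = 0" "C k 0 = 0" if "1 < k" "k < Suc m" for k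
      using interior[of "k - 1"] that by (auto simp: C_def q q')
  qed
  also have "rank_on {..Suc m} {..Suc m} C = rank_on (q ` {..Suc m}) (q ` {..Suc m}) N"
    unfolding C_def by (rule rank_on_reindex[OF inj inj, symmetric])
  finally show False using even[of "q ` {..Suc m}"] qI by auto
qed

subsection \<open>Sign scalings\<close>

lemma diag_eq_0_if_even_rank_on:
  assumes "even (rank_on {i} {i} M)"
  shows "M i i = 0"
proof (rule ccontr)
  assume "M i i \<noteq> 0"
  hence "rank_on {i} {i} M = 1" by (intro rank_on_single_entry[of _ i _ i]) auto
  thus False using assms by simp
qed

text \<open>Otherwise the 2x2 matrix would have exactly one nonzero entry and therefore rank
  one.\<close>

lemma symmetric_support_if_even_rank_on:
  assumes "even (rank_on {i, j} {i, j} M)" "M i i = 0" "M j j = 0" "M i j = 0"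
  shows "M j i = 0"
proof (rule ccontr)
  assume "M j i \<noteq> 0"
  hence "rank_on {i, j} {i, j} M = 1" using assms by (intro rank_on_single_entry[of _ j _ i]) auto
  thus False using assms by simp
qed

text \<open>Row signs are enough for the converse: \<open>f\<close> supplies \<open>D\<close>, and
  \<open>E\<close> can be the identity.\<close>

lemma exists_skew_row_scaling:
  fixes M :: "'b \<Rightarrow> 'b \<Rightarrow> 'a::field"
  assumes "finite I"
    and "\<And>i j. i \<in> I \<Longrightarrow> j \<in> I \<Longrightarrow> M i j \<in> {0, 1, -1}"
    and "\<And>K. K \<subseteq> I \<Longrightarrow> even (rank_on K K M)"
  shows "\<exists>f. (\<forall>i. f i \<in> {1, -1}) \<and> (\<forall>i\<in>I. \<forall>j\<in>I. f i * M i j = - (f j * M j i))"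
  using assms
proof (induction I rule: finite_induct)
  case empty
  show ?case by (intro exI[of _ "\<lambda>_. 1"]) auto
next
  case (insert v J)
  note entries = insert.prems(1) and even = insert.prems(2)
  have "\<exists>f. (\<forall>i. f i \<in> {1, -1}) \<and> (\<forall>i\<in>J. \<forall>j\<in>J. f i * M i j = - (f j * M j i))"
    by (rule insert.IH) (use entries in blast, use even in blast)
  then obtain f0 where f0: "\<And>i. f0 i \<in> {1, -1}"
    "\<And>i j. i \<in> J \<Longrightarrow> j \<in> J \<Longrightarrow> f0 i * M i j = - (f0 j * M j i)" by blast
  \<comment> \<open>\<open>f0\<close> is constrained on \<open>J\<close> only, so its value at
    \<open>v\<close> may be normalized to 1.\<close>
  define f where "f = f0(v := 1)"
  have f: "f i \<in> {1, -1}" "f v = 1" for i using f0(1) by (auto simp: f_def)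
  have f_skew: "f i * M i j = - (f j * M j i)" if "i \<in> J" "j \<in> J" for i j
  proof -
    have "i \<noteq> v" "j \<noteq> v" using insert.hyps that by auto
    thus ?thesis using f0(2)[OF that] by (simp add: f_def)
  qed
  define N where "N = (\<lambda>i j. f i * M i j)"
  have f_nz: "f i \<noteq> 0" for i using f(1)[of i] by auto
  have diag: "M i i = 0" if "i \<in> insert v J" for i
    by (rule diag_eq_0_if_even_rank_on) (use even that in auto)
  have supp: "M j i = 0" if "i \<in> insert v J" "j \<in> insert v J" "M i j = 0" for i j
    by (rule symmetric_support_if_even_rank_on[of i j]) (use even that diag in auto)
  have N_entries: "N i j \<in> {0, 1, -1}" if "i \<in> insert v J" "j \<in> insert v J" for i j
    using entries[OF that] f(1)[of i] by (auto simp: N_def)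
  have N_sign: "N j v = N v j \<or> N j v = - N v j" if "j \<in> J" for j
  proof -
    have "N j v \<in> {0, 1, -1}" "N v j \<in> {0, 1, -1}"
      using N_entries[of j v] N_entries[of v j] that by auto
    moreover have "N j v = 0 \<longleftrightarrow> N v j = 0"
      using supp[of j v] supp[of v j] that f_nz by (auto simp: N_def)
    ultimately show ?thesis by auto
  qed
  define R where "R = {(a, b). a \<in> J \<and> b \<in> J \<and> N a b \<noteq> 0}"
  \<comment> \<open>\<open>C\<close> is the union of the components of \<open>J\<close> that contain
    a vertex whose pair with \<open>v\<close> is not yet skew; these are the components to
    flip.\<close>
  define C where "C = {u \<in> J. \<exists>x\<in>J. N x v \<noteq> - N v x \<and> (x, u) \<in> R\<^sup>*}"
  have C_closed: "b \<in> C" if "a \<in> C" "(a, b) \<in> R" for a b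
  proof -
    have "b \<in> J" using that by (auto simp: R_def)
    with that show ?thesis unfolding C_def by (auto intro: rtrancl_into_rtrancl)
  qed
  have C_sign: "N j v = (if j \<in> C then N v j else - N v j)" if j: "j \<in> J" for j
  proof (cases "j \<in> C")
    case True
    then obtain x where x: "x \<in> J" "N x v \<noteq> - N v x" "(x, j) \<in> R\<^sup>*" by (auto simp: C_def)
    have "N j v = N v j"
    proof (rule ccontr)
      assume ne: "N j v \<noteq> N v j"
      show False
      proof (rule no_sign_conflict_along_path[where v = v and J = J and N = N and x = x and y = j])
        show "even (rank_on K K N)" if "K \<subseteq> insert v J" for K
          using rank_on_scale[of K f K "\<lambda>_. 1" M] even[OF that] f_nz by (simp add: N_def)
        show "N i i = 0" if "i \<in> insert v J" for i using diag[OF that] by (simp add: N_def)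
        show "(x, j) \<in> {(a, b). a \<in> J \<and> b \<in> J \<and> N a b \<noteq> 0}\<^sup>*" using x(3) by (simp add: R_def)
        show "N i j = - N j i" if "i \<in> J" "j \<in> J" for i j
          unfolding N_def by (rule f_skew[OF that])
      qed (fact insert.hyps(2) N_entries N_sign x(1,2) ne)+
    qed
    with True show ?thesis by simp
  next
    case False
    hence "N j v = - N v j" using j by (auto simp: C_def)
    with False show ?thesis by simp
  qed
  define g where "g = (\<lambda>i. if i \<in> C then - f i else f i)"
  have "v \<notin> C" using insert.hyps by (auto simp: C_def)
  hence gv: "g v = 1" using f by (simp add: g_def)
  have v_col: "g j * M j v = - M v j" if "j \<in> J" for j
    using C_sign[OF that] f(2) by (auto simp: g_def N_def)
  have in_J: "g i * M i j = - (g j * M j i)" if ij: "i \<in> J" "j \<in> J" for i j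
  proof (cases "M i j = 0")
    case True
    thus ?thesis using supp[of i j] ij by simp
  next
    case False
    hence "M j i \<noteq> 0" using supp[of j i] ij by auto
    hence "(i, j) \<in> R" "(j, i) \<in> R" using False ij f_nz by (auto simp: R_def N_def)
    \<comment> \<open>By the symmetric support, edges can be followed both ways, so both ends of an
      edge are flipped or neither is.\<close>
    hence "i \<in> C \<longleftrightarrow> j \<in> C" using C_closed by blast
    thus ?thesis using f_skew[OF ij] by (auto simp: g_def)
  qed
  have "g i * M i j = - (g j * M j i)" if "i \<in> insert v J" "j \<in> insert v J" for i j
    using that in_J[of i j] v_col[of i] v_col[of j] gv diag[of v] by auto
  moreover have "g i \<in> {1, -1}" for i using f(1)[of i] by (auto simp: g_def)
  ultimately show ?case by blast
qed

section \<open>Return to matrices and proof of the equivalence\<close>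

lemma sign_diag_conjugate:
  assumes "A \<in> carrier_mat n n" "sign_diag n D" "sign_diag n E"
  shows "D * A * E = mat n n (\<lambda>(i, j). D $$ (i, i) * A $$ (i, j) * E $$ (j, j))"
proof -
  have diag: "X = mat_diag n (\<lambda>i. X $$ (i, i))" if "sign_diag n X" for X :: "'a::field mat"
    using that by (intro eq_matI) (auto simp: sign_diag_def diagonal_mat_def mat_diag_def)
  have "D * A = mat n n (\<lambda>(i, j). D $$ (i, i) * A $$ (i, j))"
    by (subst diag[OF assms(2)], subst mat_diag_mult_left[OF assms(1)]) simp
  moreover have "\<dots> * E = mat n n (\<lambda>(i, j). D $$ (i, i) * A $$ (i, j) * E $$ (j, j))"
    by (subst diag[OF assms(3)], subst mat_diag_mult_right[of _ n]) auto
  ultimately show ?thesis by simp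
qed

theorem mainTheorem2:
  fixes A :: "'a::field mat" and n :: nat
  assumes "A \<in> carrier_mat n n"
    and "\<forall>i < n. \<forall>j < n. A $$ (i, j) \<in> {0, 1, -1}"
  shows "(\<forall>I \<subseteq> {0..<n}. even (mat_rank (principal_submatrix A I))) \<longleftrightarrow>
         (\<exists>D E. sign_diag n D \<and> sign_diag n E \<and> skew_symmetric (D * A * E))"
proof
  assume ev: "\<forall>I \<subseteq> {0..<n}. even (mat_rank (principal_submatrix A I))"
  let ?M = "\<lambda>i j. A $$ (i, j)"
  have "\<exists>f. (\<forall>i. f i \<in> {1, -1}) \<and> (\<forall>i\<in>{0..<n}. \<forall>j\<in>{0..<n}. f i * ?M i j = - (f j * ?M j i))"
    by (rule exists_skew_row_scaling)
      (use assms ev in \<open>auto simp: mat_rank_principal_submatrix\<close>)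
  then obtain f where f: "\<And>i. f i \<in> {1, -1}"
    "\<And>i j. i < n \<Longrightarrow> j < n \<Longrightarrow> f i * A $$ (i, j) = - (f j * A $$ (j, i))"
    by (metis atLeastLessThan_iff le0)
  have diag: "A $$ (i, i) = 0" if "i < n" for i
  proof (rule diag_eq_0_if_even_rank_on[of i ?M])
    have "{i} \<subseteq> {0..<n}" using that by simp
    thus "even (rank_on {i} {i} ?M)"
      using ev mat_rank_principal_submatrix[OF assms(1)] by metis
  qed
  have D: "sign_diag n (mat_diag n f)" and E: "sign_diag n (1\<^sub>m n :: 'a mat)"
    using f(1) by (auto simp: sign_diag_def diagonal_mat_def mat_diag_def)
  let ?S = "mat n n (\<lambda>(i, j). f i * A $$ (i, j))"
  have "mat_diag n f * A * 1\<^sub>m n = ?S"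
    unfolding sign_diag_conjugate[OF assms(1) D E] by (rule eq_matI) (auto simp: mat_diag_def)
  moreover have "transpose_mat ?S = - ?S"
  proof (rule eq_matI)
    fix i j assume "i < dim_row (- ?S)" "j < dim_col (- ?S)"
    thus "transpose_mat ?S $$ (i, j) = (- ?S) $$ (i, j)" using f(2)[of j i] by simp
  qed auto
  ultimately have "skew_symmetric (mat_diag n f * A * 1\<^sub>m n)"
    using diag by (simp add: skew_symmetric_def)
  with D E show "\<exists>D E. sign_diag n D \<and> sign_diag n E \<and> skew_symmetric (D * A * E)" by blast
next
  assume "\<exists>D E. sign_diag n D \<and> sign_diag n E \<and> skew_symmetric (D * A * E)"
  then obtain D E where D: "sign_diag n D" and E: "sign_diag n E"
    and skew: "skew_symmetric (D * A * E)" by blast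
  define S where "S = (\<lambda>i j. D $$ (i, i) * A $$ (i, j) * E $$ (j, j))"
  have DAE: "D * A * E = mat n n (\<lambda>(i, j). S i j)"
    unfolding S_def by (rule sign_diag_conjugate[OF assms(1) D E])
  have S: "S i j = - S j i" "S i i = 0" if "i < n" "j < n" for i j
  proof -
    have "transpose_mat (mat n n (\<lambda>(i, j). S i j)) $$ (j, i) = (- mat n n (\<lambda>(i, j). S i j)) $$ (j, i)"
      using skew unfolding DAE skew_symmetric_def by simp
    thus "S i j = - S j i" using that by simp
    show "S i i = 0" using skew that unfolding DAE skew_symmetric_def by auto
  qed
  show "\<forall>I \<subseteq> {0..<n}. even (mat_rank (principal_submatrix A I))"
  proof (intro allI impI)
    fix I assume I: "I \<subseteq> {0..<n}"
    have "even (rank_on I I S)"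
    proof (rule even_rank_on_alternating)
      show "finite I" using I finite_subset by blast
      show "S i i = 0" if "i \<in> I" for i using S(2)[of i i] I that by auto
      show "S i j = - S j i" if "i \<in> I" "j \<in> I" for i j by (rule S(1)) (use I that in auto)
    qed
    \<comment> \<open>Signs are nonzero, so rescaling rows and columns preserves the rank on every
      \<open>I\<close>.\<close>
    also have "rank_on I I S = rank_on I I (\<lambda>i j. A $$ (i, j))"
      unfolding S_def by (rule rank_on_scale) (use I D E in \<open>force simp: sign_diag_def\<close>)+
    finally show "even (mat_rank (principal_submatrix A I))"
      by (simp add: mat_rank_principal_submatrix[OF assms(1) I])
  qed
qed

end
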